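(* Let $\alpha$ be a well-formed simple loop with $\mu = \mathrm{update}(\alpha)$, and let $b$ be a metering function for $\alpha$. Then for every integer substitution $\sigma$ with $\mathcal{V}(\alpha) \subseteq \mathrm{dom}(\sigma)$ and $\sigma \models b \geq 0$ there is an evaluation of length $\lceil b\sigma \rceil$ \[ \mathrm{lhs}(\alpha)\,\sigma \to_{\alpha} \mathrm{lhs}(\alpha)\,\mu\,\sigma \to_{\alpha} \mathrm{lhs}(\alpha)\,\mu^2\,\sigma \to_{\alpha} \cdots \to_{\alpha} \mathrm{lhs}(\alpha)\,\mu^{\lceil b\sigma\rceil}\,\sigma, \] where $\mu^k \circ \sigma \models \mathrm{guard}(\alpha)$ for all $0 \leq k < b\sigma$.
   Context: Fix a finite set $\Sigma$ of function symbols, all of the same arity $k$, and a countably infinite set $\mathcal{V}$ of variables ranging over $\mathbb{Z}$. Arithmetic expressions are built from variables, numbers and operations such as $+,-,\cdot$, division and exponentiation. A constraint is a finite conjunction of inequations $s \circ t$ with $\circ \in \{<,\leq,>,\geq\}$ between arithmetic expressions. A term is $g(t_1,\ldots,t_k)$ with $g\in\Sigma$ and arithmetic expressions $t_i$. A rule has the form $f(\vec{x}) \xrightarrow{c} T\ [\varphi]$, where $\vec{x}=(x_1,\dots,x_k)$ is a fixed vector of pairwise different program variables, $f\in\Sigma$, the cost $c$ is an arithmetic expression, $T$ is a finite multiset of terms (the right-hand side) and $\varphi$ is a constraint (the guard); we write $\mathrm{lhs}(\alpha),\mathrm{rhs}(\alpha),\mathrm{cost}(\alpha),\mathrm{guard}(\alpha)$,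 and $\mathcal{V}(\cdot)$ for the set of variables occurring in an object. A substitution maps variables to arithmetic expressions (identity outside its domain), is applied homomorphically and written $t\sigma$; composition satisfies $t(\theta\circ\sigma) = t\theta\sigma$ ($\theta$ applied first), and $\mu^k$ is the $k$-fold composition of $\mu$ ($\mu^0$ the identity). An integer substitution maps every variable in its domain to an integer; $\sigma\models\varphi$ means $\mathcal{V}(\varphi)\subseteq\mathrm{dom}(\sigma)$ and $\sigma$ is a model of $\varphi$; $\sigma\models\alpha$ means $\mathcal{V}(\alpha)\subseteq\mathrm{dom}(\sigma)$ and $\sigma\models\mathrm{guard}(\alpha)$. A quantifier-free formula is valid if every integer substitution whose domain contains its variables is a model of it. Equalities are modulo arithmetic evaluation. A configuration is a finite multiset of terms $f(n_1,\dots,n_k)$ with $n_i\in\mathbb{Z}$. For a set of rules $P$, $S \xrightarrow{k}_P T$ holds if there are $s\in S$, a rule $\alpha = f(\vec x)\xrightarrow{c} Q\ [\varphi]\in P$ and an integer substitution $\sigma$ with $\mathcal{V}(\alpha)\subseteq\mathrm{dom}(\sigma)$, $f(\vec x)\sigma = s$, $\sigma\models\varphi$, $c\sigma = k$ and $T = (S\setminus\{s\})\cup Q\sigma$ (multiset operations); $\to_\alpha$ means $\to_{\{\alpha\}}$. A rule $\alpha$ is well formed if $t_i\sigma\in\mathbb{Z}$ for every $f(t_1,\dots,t_k)\in\mathrm{rhs}(\alpha)$, every $i$, and every integer substitution $\sigma$ with $\sigma\models\alpha$. A simple loop is a rule $\alpha$ of the form $f(\vec x)\xrightarrow{c} f(\vec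 x)\mu\ [\varphi]$ (right-hand side a single term with the same root $f$), where $\mu$ is a substitution with $\mathrm{dom}(\mu)\subseteq\vec x$; we write $\mathrm{update}(\alpha)=\mu$. An arithmetic expression $b$ is a metering function for a simple loop $\alpha$ with $\mathrm{update}(\alpha)=\mu$ if $\neg\mathrm{guard}(\alpha)\implies b\leq 0$ and $\mathrm{guard}(\alpha)\implies b\mu\geq b-1$ are both valid. *)

theory Defs
  imports Complex_Main "HOL-Library.Multiset" "HOL-Library.Countable"
    "HOL-Library.Infinite_Typeclass"
begin

datatype (vars: 'v) expr =
    Var 'v
  | Num real
  | Add "'v expr" "'v expr"
  | Sub "'v expr" "'v expr"
  | Mul "'v expr" "'v expr"
  | Div "'v expr" "'v expr"
  | Pow "'v expr" "'v expr"

text \<open>Arithmetic is over the reals and total: division by 0 yields 0, as in HOL.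
  Integer exponents need a case of their own, since \<open>powr\<close> is meaningful only for
  positive bases.\<close>

definition rpow :: "real \<Rightarrow> real \<Rightarrow> real" where
  "rpow a b = (if b \<in> \<int> then a powi \<lfloor>b\<rfloor> else a powr b)"

primrec eval :: "('v \<Rightarrow> real) \<Rightarrow> 'v expr \<Rightarrow> real" where
  "eval \<rho> (Var x) = \<rho> x"
| "eval \<rho> (Num r) = r"
| "eval \<rho> (Add s t) = eval \<rho> s + eval \<rho> t"
| "eval \<rho> (Sub s t) = eval \<rho> s - eval \<rho> t"
| "eval \<rho> (Mul s t) = eval \<rho> s * eval \<rho> t"
| "eval \<rho> (Div s t) = eval \<rho> s / eval \<rho> t"
| "eval \<rho> (Pow s t) = rpow (eval \<rho> s) (eval \<rho> t)"

text \<open>The value of a variable-free expression; the environment is then irrelevant.\<close>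

definition val :: "'v expr \<Rightarrow> real" where
  "val e = eval (\<lambda>_. 0) e"

text \<open>Being an integer is understood modulo arithmetic evaluation.\<close>

definition is_int :: "'v expr \<Rightarrow> bool" where
  "is_int e \<longleftrightarrow> vars e = {} \<and> val e \<in> \<int>"

datatype cmp = Lt | Le | Gt | Ge

primrec holds :: "cmp \<Rightarrow> real \<Rightarrow> real \<Rightarrow> bool" where
  "holds Lt a b \<longleftrightarrow> a < b"
| "holds Le a b \<longleftrightarrow> a \<le> b"
| "holds Gt a b \<longleftrightarrow> a > b"
| "holds Ge a b \<longleftrightarrow> a \<ge> b"

datatype (ineq_vars: 'v) ineq = Ineq "'v expr" cmp "'v expr"

text \<open>A list of inequations stands for their conjunction.\<close>

type_synonym 'v constraint = "'v ineq list"

datatype (form_vars: 'v) form =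
    Con "'v constraint"
  | Neg "'v form"
  | Imp "'v form" "'v form"

datatype ('f, trm_vars: 'v) trm = Fun (root: 'f) (args: "'v expr list")

datatype ('f, 'v) rule =
  Rule (lhs: "('f, 'v) trm") (cost: "'v expr") (rhs: "('f, 'v) trm multiset")
    (guard: "'v constraint")

definition rule_vars :: "('f, 'v) rule \<Rightarrow> 'v set" where
  "rule_vars \<alpha> = trm_vars (lhs \<alpha>) \<union> vars (cost \<alpha>) \<union> (\<Union>t\<in>set_mset (rhs \<alpha>). trm_vars t)
     \<union> form_vars (Con (guard \<alpha>))"

text \<open>The arity shared by all function symbols is the length of the vector \<open>xs\<close> of
  program variables.\<close>

definition is_trm :: "'f set \<Rightarrow> 'v list \<Rightarrow> ('f, 'v) trm \<Rightarrow> bool" where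
  "is_trm Sig xs t \<longleftrightarrow> root t \<in> Sig \<and> length (args t) = length xs"

definition is_rule :: "'f set \<Rightarrow> 'v list \<Rightarrow> ('f, 'v) rule \<Rightarrow> bool" where
  "is_rule Sig xs \<alpha> \<longleftrightarrow>
     (\<exists>f\<in>Sig. lhs \<alpha> = Fun f (map Var xs)) \<and> (\<forall>t\<in>#rhs \<alpha>. is_trm Sig xs t)"

type_synonym 'v subst = "'v \<Rightarrow> 'v expr"

definition sdom :: "'v subst \<Rightarrow> 'v set" where
  "sdom \<sigma> = {x. \<sigma> x \<noteq> Var x}"

primrec subst :: "'v subst \<Rightarrow> 'v expr \<Rightarrow> 'v expr" where
  "subst \<sigma> (Var x) = \<sigma> x"
| "subst \<sigma> (Num r) = Num r"
| "subst \<sigma> (Add s t) = Add (subst \<sigma> s) (subst \<sigma> t)"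
| "subst \<sigma> (Sub s t) = Sub (subst \<sigma> s) (subst \<sigma> t)"
| "subst \<sigma> (Mul s t) = Mul (subst \<sigma> s) (subst \<sigma> t)"
| "subst \<sigma> (Div s t) = Div (subst \<sigma> s) (subst \<sigma> t)"
| "subst \<sigma> (Pow s t) = Pow (subst \<sigma> s) (subst \<sigma> t)"

primrec subst_trm :: "'v subst \<Rightarrow> ('f, 'v) trm \<Rightarrow> ('f, 'v) trm" where
  "subst_trm \<sigma> (Fun f ts) = Fun f (map (subst \<sigma>) ts)"

text \<open>The first argument is applied first.\<close>

definition subst_comp :: "'v subst \<Rightarrow> 'v subst \<Rightarrow> 'v subst" where
  "subst_comp \<theta> \<sigma> = (\<lambda>x. subst \<sigma> (\<theta> x))"

primrec spow :: "'v subst \<Rightarrow> nat \<Rightarrow> 'v subst" where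
  "spow \<mu> 0 = Var"
| "spow \<mu> (Suc n) = subst_comp (spow \<mu> n) \<mu>"

definition int_subst :: "'v subst \<Rightarrow> bool" where
  "int_subst \<sigma> \<longleftrightarrow> (\<forall>x\<in>sdom \<sigma>. is_int (\<sigma> x))"

primrec sat_ineq :: "'v subst \<Rightarrow> 'v ineq \<Rightarrow> bool" where
  "sat_ineq \<sigma> (Ineq s r t) \<longleftrightarrow> holds r (val (subst \<sigma> s)) (val (subst \<sigma> t))"

primrec sat :: "'v subst \<Rightarrow> 'v form \<Rightarrow> bool" where
  "sat \<sigma> (Con \<phi>) \<longleftrightarrow> (\<forall>a\<in>set \<phi>. sat_ineq \<sigma> a)"
| "sat \<sigma> (Neg \<phi>) \<longleftrightarrow> \<not> sat \<sigma> \<phi>"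
| "sat \<sigma> (Imp \<phi> \<psi>) \<longleftrightarrow> (sat \<sigma> \<phi> \<longrightarrow> sat \<sigma> \<psi>)"

definition models :: "'v subst \<Rightarrow> 'v form \<Rightarrow> bool" where
  "models \<sigma> \<phi> \<longleftrightarrow> int_subst \<sigma> \<and> form_vars \<phi> \<subseteq> sdom \<sigma> \<and> sat \<sigma> \<phi>"

definition models_rule :: "'v subst \<Rightarrow> ('f, 'v) rule \<Rightarrow> bool" where
  "models_rule \<sigma> \<alpha> \<longleftrightarrow> rule_vars \<alpha> \<subseteq> sdom \<sigma> \<and> models \<sigma> (Con (guard \<alpha>))"

definition valid :: "'v form \<Rightarrow> bool" where
  "valid \<phi> \<longleftrightarrow> (\<forall>\<sigma>. int_subst \<sigma> \<and> form_vars \<phi> \<subseteq> sdom \<sigma> \<longrightarrow> sat \<sigma> \<phi>)"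

text \<open>Equality of variable-free terms modulo arithmetic evaluation.\<close>

definition trm_eq :: "('f, 'v) trm \<Rightarrow> ('f, 'v) trm \<Rightarrow> bool" where
  "trm_eq s t \<longleftrightarrow> root s = root t \<and> list_all2 (\<lambda>a b. val a = val b) (args s) (args t)"

definition is_config :: "'f set \<Rightarrow> 'v list \<Rightarrow> ('f, 'v) trm multiset \<Rightarrow> bool" where
  "is_config Sig xs S \<longleftrightarrow> (\<forall>t\<in>#S. is_trm Sig xs t \<and> (\<forall>e\<in>set (args t). is_int e))"

definition step :: "'f set \<Rightarrow> 'v list \<Rightarrow> ('f, 'v) rule set \<Rightarrow> real \<Rightarrow>
    ('f, 'v) trm multiset \<Rightarrow> ('f, 'v) trm multiset \<Rightarrow> bool" where
  "step Sig xs P k S T \<longleftrightarrow> is_config Sig xs S \<and> is_config Sig xs T \<and>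
     (\<exists>s \<alpha> \<sigma>. s \<in># S \<and> \<alpha> \<in> P \<and> int_subst \<sigma> \<and> rule_vars \<alpha> \<subseteq> sdom \<sigma> \<and>
        trm_eq (subst_trm \<sigma> (lhs \<alpha>)) s \<and> models \<sigma> (Con (guard \<alpha>)) \<and>
        val (subst \<sigma> (cost \<alpha>)) = k \<and>
        rel_mset trm_eq T ((S - {#s#}) + image_mset (subst_trm \<sigma>) (rhs \<alpha>)))"

text \<open>\<open>C 0, \<dots>, C n\<close> is an evaluation of length \<open>n\<close>, with arbitrary step costs.\<close>

definition evaluation :: "'f set \<Rightarrow> 'v list \<Rightarrow> ('f, 'v) rule set \<Rightarrow> nat \<Rightarrow>
    (nat \<Rightarrow> ('f, 'v) trm multiset) \<Rightarrow> bool" where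
  "evaluation Sig xs P n C \<longleftrightarrow>
     (\<forall>i\<le>n. is_config Sig xs (C i)) \<and> (\<forall>i<n. \<exists>k. step Sig xs P k (C i) (C (Suc i)))"

definition well_formed :: "('f, 'v) rule \<Rightarrow> bool" where
  "well_formed \<alpha> \<longleftrightarrow> (\<forall>t\<in>#rhs \<alpha>. \<forall>e\<in>set (args t). \<forall>\<sigma>.
     int_subst \<sigma> \<and> models_rule \<sigma> \<alpha> \<longrightarrow> is_int (subst \<sigma> e))"

definition is_update :: "'v list \<Rightarrow> ('f, 'v) rule \<Rightarrow> 'v subst \<Rightarrow> bool" where
  "is_update xs \<alpha> \<mu> \<longleftrightarrow> sdom \<mu> \<subseteq> set xs \<and> rhs \<alpha> = {#subst_trm \<mu> (lhs \<alpha>)#}"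

definition simple_loop :: "'f set \<Rightarrow> 'v list \<Rightarrow> ('f, 'v) rule \<Rightarrow> bool" where
  "simple_loop Sig xs \<alpha> \<longleftrightarrow> is_rule Sig xs \<alpha> \<and> (\<exists>\<mu>. is_update xs \<alpha> \<mu>)"

text \<open>For a simple loop the update is unique, since its left-hand side lists all of \<open>xs\<close>.\<close>

definition update :: "'v list \<Rightarrow> ('f, 'v) rule \<Rightarrow> 'v subst" where
  "update xs \<alpha> = (THE \<mu>. is_update xs \<alpha> \<mu>)"

definition metering_function :: "'v list \<Rightarrow> ('f, 'v) rule \<Rightarrow> 'v expr \<Rightarrow> bool" where
  "metering_function xs \<alpha> b \<longleftrightarrow>
     valid (Imp (Neg (Con (guard \<alpha>))) (Con [Ineq b Le (Num 0)])) \<and>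
     valid (Imp (Con (guard \<alpha>))
       (Con [Ineq (subst (update xs \<alpha>) b) Ge (Sub b (Num 1))]))"

end

theory Submission
  imports Defs
begin

text \<open>Write \<open>\<sigma>\<^sub>k\<close> for \<open>\<mu>\<^sup>k \<circ> \<sigma>\<close>. By associativity \<open>\<sigma>\<^sub>k\<^sub>+\<^sub>1 = \<mu> \<circ> \<sigma>\<^sub>k\<close>, so as long as the guard holds under
  \<open>\<sigma>\<^sub>k\<close>, well-formedness makes \<open>\<sigma>\<^sub>k\<^sub>+\<^sub>1\<close> an integer substitution with at least the domain of \<open>\<sigma>\<close>, and
  the value of \<open>b\<close> drops by at most 1. Hence \<open>b\<sigma>\<^sub>k \<ge> b\<sigma> - k\<close>, which is positive for \<open>k < b\<sigma>\<close>; since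
  \<open>b \<le> 0\<close> whenever the guard fails, the guard holds under \<open>\<sigma>\<^sub>k\<close> for all these \<open>k\<close>.\<close>

lemma subst_subst: "subst \<sigma> (subst \<theta> e) = subst (subst_comp \<theta> \<sigma>) e"
  by (induction e) (simp_all add: subst_comp_def)

lemma subst_Var: "subst Var e = e"
  by (induction e) simp_all

lemma subst_trm_subst_trm: "subst_trm \<sigma> (subst_trm \<theta> t) = subst_trm (subst_comp \<theta> \<sigma>) t"
  by (cases t) (simp add: subst_subst)

lemma subst_comp_assoc:
  "subst_comp (subst_comp \<theta> \<sigma>) \<tau> = subst_comp \<theta> (subst_comp \<sigma> \<tau>)"
  by (simp add: subst_comp_def subst_subst)

lemma subst_comp_Var [simp]: "subst_comp Var \<sigma> = \<sigma>" "subst_comp \<sigma> Var = \<sigma>"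
  by (simp_all add: subst_comp_def subst_Var)

text \<open>\<open>spow\<close> appends each new factor on the right. Peeling one off on the left
  instead lets a loop step be read as \<open>\<mu>\<close> followed by the current instance.\<close>

lemma spow_Suc_left: "spow \<mu> (Suc n) = subst_comp \<mu> (spow \<mu> n)"
  by (induction n) (simp_all add: subst_comp_assoc)

lemma spow_Suc_comp:
  "subst_comp (spow \<mu> (Suc n)) \<sigma> = subst_comp \<mu> (subst_comp (spow \<mu> n) \<sigma>)"
  by (simp only: spow_Suc_left subst_comp_assoc)

lemma vars_subst: "vars (subst \<sigma> e) = (\<Union>x\<in>vars e. vars (\<sigma> x))"
  by (induction e) auto

lemma trm_eq_refl: "trm_eq t t"
  by (simp add: trm_eq_def list.rel_refl)

text \<open>Comparing the two right-hand sides fixes the images of the variables in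
  \<open>xs\<close>; outside \<open>xs\<close> the domain condition makes both substitutions the
  identity.\<close>

lemma is_update_unique:
  assumes "is_rule Sig xs \<alpha>" "is_update xs \<alpha> \<mu>" "is_update xs \<alpha> \<nu>"
  shows "\<mu> = \<nu>"
proof
  fix x
  obtain f where f: "lhs \<alpha> = Fun f (map Var xs)"
    using assms(1) by (auto simp: is_rule_def)
  have "map \<mu> xs = map \<nu> xs"
    using assms(2,3) f by (simp add: is_update_def comp_def)
  moreover have "\<mu> x = Var x" "\<nu> x = Var x" if "x \<notin> set xs"
    using that assms(2,3) unfolding is_update_def sdom_def by blast+
  ultimately show "\<mu> x = \<nu> x"
    by (cases "x \<in> set xs") auto
qed

lemma is_update_update:
  assumes "simple_loop Sig xs \<alpha>"
  shows "is_update xs \<alpha> (update xs \<alpha>)"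
proof -
  obtain \<mu> where "is_rule Sig xs \<alpha>" "is_update xs \<alpha> \<mu>"
    using assms by (auto simp: simple_loop_def)
  then show ?thesis
    unfolding update_def by (metis is_update_unique theI)
qed

text \<open>Since \<open>sdom\<close> consists of the variables that are moved, this puts every
  variable with an integer image into the domain.\<close>

lemma is_int_not_Var: "is_int e \<Longrightarrow> e \<noteq> Var x"
  by (auto simp: is_int_def)

text \<open>Fixing \<open>\<mu>\<close> through \<open>is_update\<close> keeps the definite
  description in \<open>update\<close> out of the lemmas about iteration.\<close>

locale well_formed_loop =
  fixes Sig :: "'f set" and xs :: "'v list" and \<alpha> :: "('f, 'v) rule" and \<mu> :: "'v subst"
  assumes rule: "is_rule Sig xs \<alpha>"
    and upd: "is_update xs \<alpha> \<mu>"
    and wf: "well_formed \<alpha>"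
begin

lemma lhs_eq: "\<exists>f\<in>Sig. lhs \<alpha> = Fun f (map Var xs)"
  using rule by (simp add: is_rule_def)

lemma rhs_eq: "rhs \<alpha> = {#subst_trm \<mu> (lhs \<alpha>)#}"
  using upd by (simp add: is_update_def)

lemma program_vars_subset: "set xs \<subseteq> rule_vars \<alpha>"
  using lhs_eq by (auto simp: rule_vars_def)

lemma sdom_update_subset: "sdom \<mu> \<subseteq> set xs"
  using upd by (simp add: is_update_def)

text \<open>The image of a program variable is an argument of the right-hand side; any other
  variable is mapped to itself. The extra \<open>x\<close> covers variables of a metering function
  that do not occur in the rule.\<close>

lemma vars_update_subset: "vars (\<mu> x) \<subseteq> insert x (rule_vars \<alpha>)"
proof (cases "x \<in> set xs")
  case True
  then show ?thesis
    using lhs_eq rhs_eq by (auto simp: rule_vars_def)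
next
  case False
  then have "\<mu> x = Var x"
    using sdom_update_subset by (auto simp: sdom_def)
  then show ?thesis by simp
qed

lemma guard_vars_subset: "form_vars (Con (guard \<alpha>)) \<subseteq> rule_vars \<alpha>"
  by (simp add: rule_vars_def)

lemma is_int_update:
  assumes "x \<in> set xs" "models_rule \<sigma> \<alpha>"
  shows "is_int (subst \<sigma> (\<mu> x))"
  using wf assms lhs_eq rhs_eq
  by (auto simp: well_formed_def models_rule_def models_def)

text \<open>On \<open>xs\<close> the new images are integers by well-formedness, and off
  \<open>xs\<close> they agree with \<open>\<sigma>\<close>. So no variable leaves the
  domain.\<close>

lemma subst_comp_update:
  assumes "models_rule \<sigma> \<alpha>"
  shows "int_subst (subst_comp \<mu> \<sigma>)" "sdom \<sigma> \<subseteq> sdom (subst_comp \<mu> \<sigma>)"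
proof -
  have int: "int_subst \<sigma>"
    using assms by (simp add: models_rule_def models_def)
  have new: "is_int (subst_comp \<mu> \<sigma> x)" if "x \<in> set xs" for x
    using is_int_update[OF that assms] by (simp add: subst_comp_def)
  have old: "subst_comp \<mu> \<sigma> x = \<sigma> x" if "x \<notin> set xs" for x
  proof -
    have "\<mu> x = Var x"
      using that sdom_update_subset unfolding sdom_def by blast
    then show ?thesis by (simp add: subst_comp_def)
  qed
  show "int_subst (subst_comp \<mu> \<sigma>)"
    unfolding int_subst_def
  proof
    fix x assume "x \<in> sdom (subst_comp \<mu> \<sigma>)"
    then show "is_int (subst_comp \<mu> \<sigma> x)"
      using new old int by (cases "x \<in> set xs") (auto simp: sdom_def int_subst_def)
  qed
  show "sdom \<sigma> \<subseteq> sdom (subst_comp \<mu> \<sigma>)"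
  proof
    fix x assume "x \<in> sdom \<sigma>"
    then show "x \<in> sdom (subst_comp \<mu> \<sigma>)"
      using new[of x] old[of x] by (cases "x \<in> set xs") (auto simp: sdom_def is_int_not_Var)
  qed
qed

lemma is_config_lhs:
  assumes "int_subst \<sigma>" "rule_vars \<alpha> \<subseteq> sdom \<sigma>"
  shows "is_config Sig xs {#subst_trm \<sigma> (lhs \<alpha>)#}"
proof -
  have "is_int (\<sigma> x)" if "x \<in> set xs" for x
    using that assms program_vars_subset unfolding int_subst_def by blast
  then show ?thesis
    using lhs_eq by (auto simp: is_config_def is_trm_def)
qed

lemma step_update:
  assumes "models_rule \<sigma> \<alpha>"
  shows "step Sig xs {\<alpha>} (val (subst \<sigma> (cost \<alpha>)))
    {#subst_trm \<sigma> (lhs \<alpha>)#} {#subst_trm (subst_comp \<mu> \<sigma>) (lhs \<alpha>)#}"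
proof -
  have "int_subst \<sigma>" "rule_vars \<alpha> \<subseteq> sdom \<sigma>" "models \<sigma> (Con (guard \<alpha>))"
    using assms by (auto simp: models_rule_def models_def)
  moreover have "is_config Sig xs {#subst_trm (subst_comp \<mu> \<sigma>) (lhs \<alpha>)#}"
    using subst_comp_update[OF assms] assms
    by (intro is_config_lhs) (auto simp: models_rule_def)
  \<comment> \<open>The instantiated right-hand side is syntactically the left-hand side under the
    composition, so no arithmetic evaluation is involved and reflexivity suffices.\<close>
  moreover have "rel_mset trm_eq {#subst_trm (subst_comp \<mu> \<sigma>) (lhs \<alpha>)#}
      ({#subst_trm \<sigma> (lhs \<alpha>)#} - {#subst_trm \<sigma> (lhs \<alpha>)#} + image_mset (subst_trm \<sigma>) (rhs \<alpha>))"
    by (auto simp: rhs_eq subst_trm_subst_trm intro!: multiset.rel_refl trm_eq_refl)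
  ultimately show ?thesis
    unfolding step_def
    by (intro conjI exI[of _ "subst_trm \<sigma> (lhs \<alpha>)"] exI[of _ \<alpha>] exI[of _ \<sigma>])
      (simp_all add: trm_eq_refl is_config_lhs)
qed

text \<open>The first two claims reach one index further than the third: the last configuration of
  the evaluation must consist of integers, but no step leaves it.\<close>

lemma metered_iteration:
  assumes b_pos: "valid (Imp (Neg (Con (guard \<alpha>))) (Con [Ineq b Le (Num 0)]))"
    and b_step: "valid (Imp (Con (guard \<alpha>)) (Con [Ineq (subst \<mu> b) Ge (Sub b (Num 1))]))"
    and \<sigma>: "int_subst \<sigma>" "rule_vars \<alpha> \<subseteq> sdom \<sigma>" "vars b \<subseteq> sdom \<sigma>"
  defines "it \<equiv> \<lambda>k. subst_comp (spow \<mu> k) \<sigma>"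
  shows int_subst_iteration: "real k < val (subst \<sigma> b) + 1 \<Longrightarrow> int_subst (it k)"
    and sdom_iteration: "real k < val (subst \<sigma> b) + 1 \<Longrightarrow> sdom \<sigma> \<subseteq> sdom (it k)"
    and models_rule_iteration: "real k < val (subst \<sigma> b) \<Longrightarrow> models_rule (it k) \<alpha>"
proof -
  have models: "models_rule \<tau> \<alpha>"
    if "int_subst \<tau>" "sdom \<sigma> \<subseteq> sdom \<tau>" "val (subst \<tau> b) > 0" for \<tau>
  proof -
    have guard_sdom: "form_vars (Con (guard \<alpha>)) \<subseteq> sdom \<tau>"
      using that(2) \<sigma>(2) guard_vars_subset by blast
    \<comment> \<open>\<open>valid\<close> speaks only about substitutions whose domain contains all
      variables of the formula, hence this side condition.\<close>
    have "form_vars (Imp (Neg (Con (guard \<alpha>))) (Con [Ineq b Le (Num 0)])) \<subseteq> sdom \<tau>"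
      using that(2) \<sigma> guard_sdom by auto
    then have "sat \<tau> (Imp (Neg (Con (guard \<alpha>))) (Con [Ineq b Le (Num 0)]))"
      using b_pos that(1) unfolding valid_def by blast
    then have "sat \<tau> (Con (guard \<alpha>))"
      using that(3) by (auto simp: val_def)
    then show ?thesis
      using that \<sigma> guard_vars_subset unfolding models_rule_def models_def by blast
  qed
  have decrease: "val (subst (subst_comp \<mu> \<tau>) b) \<ge> val (subst \<tau> b) - 1"
    if "models_rule \<tau> \<alpha>" "sdom \<sigma> \<subseteq> sdom \<tau>" for \<tau>
  proof -
    have guard_sdom: "form_vars (Con (guard \<alpha>)) \<subseteq> sdom \<tau>"
      using that(2) \<sigma>(2) guard_vars_subset by blast
    \<comment> \<open>The update may bring new variables into \<open>b\<close>, but only variables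
      of the rule, which the domain of \<open>\<sigma>\<close> contains.\<close>
    have "vars (subst \<mu> b) \<subseteq> sdom \<tau>"
      using vars_update_subset that(2) \<sigma>(2,3) unfolding vars_subst by blast
    then have "form_vars (Imp (Con (guard \<alpha>)) (Con [Ineq (subst \<mu> b) Ge (Sub b (Num 1))]))
        \<subseteq> sdom \<tau>"
      using that(2) \<sigma> guard_sdom by auto
    then have "sat \<tau> (Imp (Con (guard \<alpha>)) (Con [Ineq (subst \<mu> b) Ge (Sub b (Num 1))]))"
      using b_step that(1) unfolding valid_def models_rule_def models_def by blast
    then show ?thesis
      using that(1) by (simp add: models_rule_def models_def val_def subst_subst)
  qed
  have inv: "int_subst (it k) \<and> sdom \<sigma> \<subseteq> sdom (it k) \<and> val (subst (it k) b) \<ge> val (subst \<sigma> b) - k"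
    if "real k < val (subst \<sigma> b) + 1" for k
    using that
  proof (induction k)
    case 0
    then show ?case using \<sigma> by (simp add: it_def)
  next
    case (Suc k)
    then have IH: "int_subst (it k)" "sdom \<sigma> \<subseteq> sdom (it k)"
      "val (subst (it k) b) \<ge> val (subst \<sigma> b) - k"
      by auto
    \<comment> \<open>The bound for \<open>Suc k\<close> says that \<open>k\<close> is below the
      initial value of \<open>b\<close>, so the value of \<open>b\<close> under \<open>it k\<close>
      is still positive.\<close>
    then have m: "models_rule (it k) \<alpha>"
      using Suc.prems by (intro models) auto
    have "it (Suc k) = subst_comp \<mu> (it k)"
      unfolding it_def by (rule spow_Suc_comp)
    then show ?case
      using subst_comp_update[OF m] decrease[OF m IH(2)] IH by auto
  qed
  show "real k < val (subst \<sigma> b) + 1 \<Longrightarrow> int_subst (it k)"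
    and "real k < val (subst \<sigma> b) + 1 \<Longrightarrow> sdom \<sigma> \<subseteq> sdom (it k)"
    using inv by blast+
  show "real k < val (subst \<sigma> b) \<Longrightarrow> models_rule (it k) \<alpha>"
    using inv[of k] by (intro models) auto
qed

end

theorem theorem3p3:
  fixes Sig :: "'f set" and xs :: "'v :: {countable, infinite} list"
    and \<alpha> :: "('f, 'v) rule" and \<mu> :: "'v subst" and b :: "'v expr"
  assumes "finite Sig" and "distinct xs"
    and "simple_loop Sig xs \<alpha>" and "well_formed \<alpha>"
    and "\<mu> = update xs \<alpha>"
    and "metering_function xs \<alpha> b"
  shows "\<forall>\<sigma>. int_subst \<sigma> \<and> rule_vars \<alpha> \<subseteq> sdom \<sigma> \<and> models \<sigma> (Con [Ineq b Ge (Num 0)]) \<longrightarrow>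
    evaluation Sig xs {\<alpha>} (nat \<lceil>val (subst \<sigma> b)\<rceil>)
      (\<lambda>i. {#subst_trm \<sigma> (subst_trm (spow \<mu> i) (lhs \<alpha>))#}) \<and>
    (\<forall>k::nat. real k < val (subst \<sigma> b) \<longrightarrow>
      models (subst_comp (spow \<mu> k) \<sigma>) (Con (guard \<alpha>)))"
proof (intro allI impI)
  fix \<sigma> assume "int_subst \<sigma> \<and> rule_vars \<alpha> \<subseteq> sdom \<sigma> \<and> models \<sigma> (Con [Ineq b Ge (Num 0)])"
  \<comment> \<open>Being a model of \<open>b \<ge> 0\<close> includes that the domain contains the
    variables of \<open>b\<close>, even those foreign to the rule.\<close>
  then have \<sigma>: "int_subst \<sigma>" "rule_vars \<alpha> \<subseteq> sdom \<sigma>" "vars b \<subseteq> sdom \<sigma>"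
    and nonneg: "val (subst \<sigma> b) \<ge> 0"
    by (auto simp: models_def val_def)
  interpret well_formed_loop Sig xs \<alpha> \<mu>
    using assms is_update_update by unfold_locales (auto simp: simple_loop_def)
  have b: "valid (Imp (Neg (Con (guard \<alpha>))) (Con [Ineq b Le (Num 0)]))"
    "valid (Imp (Con (guard \<alpha>)) (Con [Ineq (subst \<mu> b) Ge (Sub b (Num 1))]))"
    using assms(5,6) by (simp_all add: metering_function_def)
  let ?it = "\<lambda>k. subst_comp (spow \<mu> k) \<sigma>" and ?n = "nat \<lceil>val (subst \<sigma> b)\<rceil>"
  have guard: "models_rule (?it k) \<alpha>" if "real k < val (subst \<sigma> b)" for k
    using models_rule_iteration[OF b \<sigma> that] .
  have "is_config Sig xs {#subst_trm (?it i) (lhs \<alpha>)#}" if "i \<le> ?n" for i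
  proof -
    \<comment> \<open>A ceiling exceeds its argument by less than 1; \<open>nonneg\<close> excludes
      that \<open>nat\<close> raises a negative ceiling to 0.\<close>
    have "real i < val (subst \<sigma> b) + 1"
      using that nonneg by linarith
    then show ?thesis
      using int_subst_iteration[OF b \<sigma>] sdom_iteration[OF b \<sigma>] \<sigma>(2)
      by (intro is_config_lhs) auto
  qed
  moreover have "\<exists>c. step Sig xs {\<alpha>} c {#subst_trm (?it i) (lhs \<alpha>)#}
      {#subst_trm (?it (Suc i)) (lhs \<alpha>)#}" if "i < ?n" for i
  proof -
    \<comment> \<open>A natural number strictly below the ceiling of a real is strictly below the
      real itself, so the guard holds at \<open>i\<close>.\<close>
    have "real i < val (subst \<sigma> b)"
      using that by linarith
    then show ?thesis
      unfolding spow_Suc_comp using step_update[OF guard] by blast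
  qed
  ultimately have "evaluation Sig xs {\<alpha>} ?n
      (\<lambda>i. {#subst_trm \<sigma> (subst_trm (spow \<mu> i) (lhs \<alpha>))#})"
    unfolding evaluation_def subst_trm_subst_trm by blast
  then show "evaluation Sig xs {\<alpha>} ?n
      (\<lambda>i. {#subst_trm \<sigma> (subst_trm (spow \<mu> i) (lhs \<alpha>))#}) \<and>
    (\<forall>k::nat. real k < val (subst \<sigma> b) \<longrightarrow> models (?it k) (Con (guard \<alpha>)))"
    using guard by (auto simp: models_rule_def)
qed

end
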